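(* Let $s\in\{+1,-1\}$ and $d\ge1$. Let $f:\mathbb T^d\to\mathbb R$ be continuous, even and nonzero, with $\widehat f\in\ell^1(\mathbb Z^d)$. Suppose there exist $r_f\in(0,1]$ and an integer $k\ge1$ such that $f(x)\ge0$ whenever $d_\infty(x,0)\ge r_f$, $\widehat f(0)\le0$, $s\widehat f(m)\ge0$ whenever $\max_j|m_j|\ge k$, and $sf(0)\le0$. Then $$r_f\,(2k-1)\ \ge\ 2^{-(1+4/d)}.$$
   Context: $\mathbb T^d=\mathbb R^d/\mathbb Z^d$ identified with $[-\tfrac12,\tfrac12]^d$, Haar probability measure $\lambda$; $\widehat f(m)=\int_{\mathbb T^d}f(x)e^{-2\pi i\langle x,m\rangle}d\lambda(x)$. $d_\infty(x,y)=\max_{1\le j\le d}|x_j-y_j|$, where $|t|$ denotes the distance from $t$ to $0$ in $\mathbb T^1=\mathbb R/\mathbb Z$. *)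

theory Defs
  imports "HOL-Analysis.Analysis"
begin

text \<open>Functions on the torus T^d are represented as functions on real^'d that are
  1-periodic in every coordinate (invariant under translation by integer vectors).
  The fundamental domain is the cube [-1/2,1/2]^d, of Lebesgue measure 1, so
  Lebesgue measure on it is the Haar probability measure.\<close>

definition torus_periodic :: "(real^'d \<Rightarrow> real) \<Rightarrow> bool" where
  "torus_periodic f \<longleftrightarrow> (\<forall>x (n::int^'d). f (x + (\<chi> j. of_int (n $ j))) = f x)"

definition torus_cube :: "(real^'d) set" where
  "torus_cube = cbox (\<chi> j. -1/2) (\<chi> j. 1/2)"

definition fourier_coeff :: "(real^'d \<Rightarrow> real) \<Rightarrow> int^'d \<Rightarrow> complex" where
  "fourier_coeff f m = integral torus_cube
     (\<lambda>x. complex_of_real (f x) * cis (- 2 * pi * (\<Sum>j\<in>UNIV. x $ j * of_int (m $ j))))"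

definition tnorm :: "real \<Rightarrow> real" where
  "tnorm t = \<bar>t - of_int (round t)\<bar>"

definition torus_dinf0 :: "real^'d \<Rightarrow> real" where
  "torus_dinf0 x = Max (range (\<lambda>j. tnorm (x $ j)))"

end

theory Submission
  imports Defs
begin

text \<open>
  Let \<open>M\<close> be the \<open>\<ell>\<^sup>1\<close> norm of the Fourier coefficients and \<open>I\<close> the \<open>L\<^sup>1\<close> norm of \<open>f\<close>. Fourier
  inversion gives \<open>\<bar>f\<bar> \<le> M\<close> and expresses \<open>f 0\<close> as the sum of the coefficients. As the integral of
  \<open>f\<close> is nonpositive, \<open>I\<close> is at most twice the integral of the negative part of \<open>f\<close>, which lives on
  a cube of side \<open>2r\<close>; hence \<open>I \<le> 2 (2r)\<^sup>d M\<close>. Dually, \<open>s f(0) \<le> 0\<close> and \<open>|f^(m)| \<le> I\<close> give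
  \<open>M \<le> 2 (2k - 1)\<^sup>d I\<close>. Together \<open>1 \<le> 4 (2r (2k - 1))\<^sup>d\<close>, slightly more than what is claimed.
  Inversion is reduced to the uniqueness of Fourier coefficients, which follows from the density of
  trigonometric polynomials.
\<close>

section \<open>Integrals of products over boxes and orthogonality of characters\<close>

text \<open>Fubini: \<open>lborel\<close> on a Euclidean space is the image of the product over
  \<open>Basis\<close> of one-dimensional Lebesgue measures.\<close>

lemma integral_cbox_prod:
  fixes f :: "'a::euclidean_space \<Rightarrow> real \<Rightarrow> complex"
  assumes cont: "\<And>b. b \<in> Basis \<Longrightarrow> continuous_on UNIV (f b)"
  shows "integral (cbox l u) (\<lambda>x. \<Prod>b\<in>Basis. f b (x \<bullet> b)) = (\<Prod>b\<in>Basis. integral {l \<bullet> b..u \<bullet> b} (f b))"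
proof -
  interpret product_sigma_finite "\<lambda>b::'a. lborel :: real measure" ..
  define g where "g b t = indicator {l \<bullet> b..u \<bullet> b} t *\<^sub>R f b t" for b t
  have int1: "set_integrable lborel {l \<bullet> b..u \<bullet> b} (f b)" if "b \<in> Basis" for b
    by (rule borel_integrable_compact[unfolded set_integrable_def[symmetric]])
       (use cont[OF that] in \<open>auto intro: continuous_on_subset\<close>)
  have gint: "integrable lborel (g b)" if "b \<in> Basis" for b
    using int1[OF that] by (simp add: set_integrable_def g_def[abs_def])
  have meas[measurable]: "f b \<in> borel_measurable borel" if "b \<in> Basis" for b
    using cont[OF that] by (rule borel_measurable_continuous_onI)
  have gmeas[measurable]: "g b \<in> borel_measurable borel" if "b \<in> Basis" for b
    using that unfolding g_def by measurable
  have geq: "integral\<^sup>L lborel (g b) = integral {l \<bullet> b..u \<bullet> b} (f b)" if "b \<in> Basis" for b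
    using set_borel_integral_eq_integral(2)[OF int1[OF that]]
    by (simp add: set_lebesgue_integral_def g_def[abs_def])
  \<comment> \<open>A point lies in the box exactly when each coordinate lies in its side, so the
    cut-off factors as well and is absorbed into the \<open>g b\<close>.\<close>
  have ind: "indicator (cbox l u) x *\<^sub>R (\<Prod>b\<in>Basis. f b (x \<bullet> b)) = (\<Prod>b\<in>Basis. g b (x \<bullet> b))" for x
    by (auto simp: g_def cbox_def indicator_def)
  have cont_prod: "continuous_on UNIV (\<lambda>x. \<Prod>b\<in>Basis. f b (x \<bullet> b))"
    by (intro continuous_on_prod continuous_on_compose2[OF cont] continuous_intros) auto
  have "set_integrable lborel (cbox l u) (\<lambda>x. \<Prod>b\<in>Basis. f b (x \<bullet> b))"
    by (rule borel_integrable_compact[unfolded set_integrable_def[symmetric]])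
       (use cont_prod in \<open>auto intro: continuous_on_subset\<close>)
  from set_borel_integral_eq_integral(2)[OF this]
  have "integral (cbox l u) (\<lambda>x. \<Prod>b\<in>Basis. f b (x \<bullet> b)) = (\<integral>x. (\<Prod>b\<in>Basis. g b (x \<bullet> b)) \<partial>lborel)"
    by (simp add: set_lebesgue_integral_def ind)
  also have "\<dots> = (\<integral>x. (\<Prod>b\<in>Basis. g b (x b)) \<partial>(\<Pi>\<^sub>M b\<in>Basis. lborel))"
    by (subst lborel_eq, subst integral_distr) (auto intro!: Bochner_Integration.integral_cong prod.cong)
  also have "\<dots> = (\<Prod>b\<in>Basis. integral {l \<bullet> b..u \<bullet> b} (f b))"
    by (subst product_integral_prod) (auto simp: gint geq)
  finally show ?thesis .
qed

lemma integral_cis_period: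
  "integral {- (1/2)..1/2} (\<lambda>t. cis (2 * pi * t * of_int n)) = (if n = 0 then 1 else 0)"
proof (cases "n = 0")
  case False
  let ?F = "\<lambda>t. cis (2 * pi * t * of_int n) / (\<i> * complex_of_real (2 * pi * of_int n))"
  have deriv: "(?F has_vector_derivative cis (2 * pi * t * of_int n)) (at t within {- (1/2)..1/2})" for t
  proof -
    define c where "c = \<i> * complex_of_real (2 * pi * of_int n)"
    have c: "c \<noteq> 0" using False by (simp add: c_def)
    have "((\<lambda>z. exp (c * z) / c) has_field_derivative exp (c * of_real t)) (at (of_real t))"
      using c by (auto intro!: derivative_eq_intros)
    from has_vector_derivative_real_field[OF this]
    show ?thesis by (simp add: cis_conv_exp c_def mult_ac)
  qed
  have "((\<lambda>t. cis (2 * pi * t * of_int n)) has_integral (?F (1/2) - ?F (- (1/2)))) {- (1/2)..1/2}"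
    by (rule fundamental_theorem_of_calculus) (simp, rule deriv)
  \<comment> \<open>The end points are a full period apart, so the antiderivative takes the same
    value at both and the integral vanishes.\<close>
  moreover have "cis (2 * pi * (1/2) * of_int n) = cis (2 * pi * (- (1/2)) * of_int n)"
  proof -
    have "cis (2 * pi * (1/2) * of_int n) = cis (2 * pi * (- (1/2)) * of_int n) * cis (2 * pi * of_int n)"
      by (simp add: cis_mult algebra_simps)
    then show ?thesis by simp
  qed
  ultimately show ?thesis using False by (simp add: integral_unique)
next
  case True
  have "integral {- (1/2)..1/2} (\<lambda>t::real. 1 :: complex) = 1"
    by (subst integral_const_real) simp
  with True show ?thesis by simp
qed

definition torus_char :: "int^'d \<Rightarrow> real^'d \<Rightarrow> complex" where
  "torus_char m x = cis (2 * pi * (\<Sum>j\<in>UNIV. x $ j * of_int (m $ j)))"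

lemma norm_torus_char [simp]: "norm (torus_char m x) = 1"
  by (simp add: torus_char_def)

lemma torus_char_0 [simp]: "torus_char 0 x = 1" "torus_char m 0 = 1"
  by (simp_all add: torus_char_def)

lemma torus_char_add: "torus_char (m + n) x = torus_char m x * torus_char n x"
  by (simp add: torus_char_def cis_mult algebra_simps sum.distrib)

lemma torus_char_periodic: "torus_char m (x + (\<chi> j. of_int (n $ j))) = torus_char m x"
proof -
  have "torus_char m (x + (\<chi> j. of_int (n $ j)))
      = torus_char m x * cis (2 * pi * of_int (\<Sum>j\<in>UNIV. n $ j * m $ j))"
    by (simp add: torus_char_def cis_mult algebra_simps sum.distrib)
  then show ?thesis by (simp del: of_int_sum of_int_mult)
qed

lemma continuous_on_torus_char [continuous_intros]: "continuous_on S (torus_char m)"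
  unfolding torus_char_def by (intro continuous_intros)

lemma fourier_coeff_eq:
  "fourier_coeff f m = integral torus_cube (\<lambda>x. complex_of_real (f x) * torus_char (- m) x)"
  by (simp add: fourier_coeff_def torus_char_def sum_negf)

text \<open>A character is a product of functions of one coordinate each, so its integral is a
  product of one-dimensional ones; a single nonzero frequency makes a factor vanish.\<close>

lemma integral_torus_char: "integral torus_cube (torus_char m) = (if m = 0 then 1 else 0)"
proof -
  \<comment> \<open>The frequency as a real vector, so that its coordinates can be indexed by
    \<open>Basis\<close>, as the product formula requires.\<close>
  define M :: "real^'a" where "M = (\<chi> j. of_int (m $ j))"
  have char: "torus_char m x = (\<Prod>b\<in>Basis. cis (2 * pi * (x \<bullet> b) * (M \<bullet> b)))" for x
  proof -
    have "(\<Sum>j\<in>UNIV. x $ j * of_int (m $ j)) = (\<Sum>b\<in>Basis. (x \<bullet> b) * (M \<bullet> b))"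
      unfolding euclidean_inner[symmetric] by (simp add: inner_vec_def M_def)
    then show ?thesis
      by (simp add: torus_char_def cis_conv_exp sum_distrib_left exp_sum mult.assoc)
  qed
  have Basis: "(Basis :: (real^'a) set) = range (\<lambda>j. axis j 1)"
    by (auto simp: Basis_vec_def)
  have "integral torus_cube (torus_char m) = (\<Prod>b\<in>Basis. integral {- (1/2)..1/2} (\<lambda>t. cis (2 * pi * t * (M \<bullet> b))))"
    unfolding torus_cube_def char[abs_def]
    by (subst integral_cbox_prod) (auto intro!: continuous_on_cis continuous_on_mult continuous_on_const continuous_on_id prod.cong simp: Basis inner_axis)
  also have "\<dots> = (\<Prod>b\<in>Basis. if M \<bullet> b = 0 then 1 else 0)"
    by (rule prod.cong) (auto simp: Basis inner_axis M_def integral_cis_period)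
  also have "\<dots> = (if m = 0 then 1 else 0)"
  proof (cases "m = 0")
    case True
    then show ?thesis by (simp add: M_def inner_vec_def)
  next
    case False
    then obtain j where "m $ j \<noteq> 0" by (auto simp: vec_eq_iff)
    then have "M \<bullet> axis j 1 \<noteq> 0" by (simp add: M_def inner_axis)
    then show ?thesis using False by (auto simp: Basis intro!: prod_zero)
  qed
  finally show ?thesis .
qed

lemma cnj_torus_char: "cnj (torus_char m x) = torus_char (- m) x"
  by (simp add: torus_char_def cis_cnj sum_negf)

lemma torus_char_axis: "torus_char (axis j n) x = cis (2 * pi * (x $ j * of_int n))"
proof -
  have "(\<Sum>i\<in>UNIV. x $ i * of_int (axis j n $ i)) = x $ j * of_int n"
    by (subst sum.remove[of _ j]) (auto simp: axis_def)
  then show ?thesis by (simp add: torus_char_def)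
qed

section \<open>Trigonometric polynomials and their density\<close>

text \<open>The linear span of the characters, generated by monomials and binary sums only, so that
  linear identities need just two induction cases; closure under products is derived.\<close>

inductive trig_poly :: "(real^'d \<Rightarrow> complex) \<Rightarrow> bool" where
  monomial: "trig_poly (\<lambda>x. c * torus_char m x)"
| add: "trig_poly p \<Longrightarrow> trig_poly q \<Longrightarrow> trig_poly (\<lambda>x. p x + q x)"

lemma trig_poly_const: "trig_poly (\<lambda>x. c)"
  using trig_poly.monomial[of c 0] by simp

lemma trig_poly_sum:
  "finite A \<Longrightarrow> (\<And>i. i \<in> A \<Longrightarrow> trig_poly (p i)) \<Longrightarrow> trig_poly (\<lambda>x. \<Sum>i\<in>A. p i x)"
  by (induction A rule: finite_induct) (auto intro: trig_poly.add trig_poly_const)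

lemma trig_poly_mult:
  assumes "trig_poly p" "trig_poly q"
  shows "trig_poly (\<lambda>x. p x * q x)"
  using assms
proof (induction p rule: trig_poly.induct)
  case (monomial c m)
  then show ?case
  proof (induction q rule: trig_poly.induct)
    case (monomial c' m')
    then show ?case
      using trig_poly.monomial[of "c * c'" "m + m'"] by (simp add: torus_char_add mult_ac)
  next
    case (add p q)
    then show ?case using trig_poly.add by (simp add: distrib_left)
  qed
next
  case (add p p')
  then show ?case using trig_poly.add by (simp add: distrib_right)
qed

lemma continuous_on_trig_poly:
  "trig_poly p \<Longrightarrow> continuous_on S p"
  by (induction rule: trig_poly.induct) (auto intro!: continuous_intros)

definition torus_embed :: "real^'d \<Rightarrow> complex^'d" where
  "torus_embed x = (\<chi> j. cis (2 * pi * x $ j))"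

lemma continuous_on_torus_embed: "continuous_on S torus_embed"
  unfolding torus_embed_def by (intro continuous_intros)

text \<open>The fibres of \<open>torus_embed\<close> are cosets of the integer lattice, because
  \<open>cis\<close> has period \<open>2 * pi\<close>. This makes the factor of a periodic function
  through the embedding well defined.\<close>

lemma torus_embed_eq_imp_periodic_eq:
  assumes "torus_periodic u" "torus_embed x = torus_embed y"
  shows "u x = u y"
proof -
  have "\<exists>n::int. x $ j = y $ j + of_int n" for j
  proof -
    have "cis (2 * pi * x $ j) = cis (2 * pi * y $ j)"
      using assms(2) by (simp add: torus_embed_def vec_eq_iff)
    then have "\<exists>n::int. 2 * pi * x $ j = 2 * pi * y $ j + 2 * pi * of_int n"
      using sin_cos_eq_iff[of "2 * pi * x $ j" "2 * pi * y $ j"] by (simp add: complex_eq_iff mult_ac)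
    then obtain n :: int where "2 * pi * x $ j = 2 * pi * (y $ j + of_int n)"
      by (auto simp: distrib_left)
    then have "x $ j = y $ j + of_int n"
      by (subst (asm) mult_cancel_left) simp
    then show ?thesis ..
  qed
  then obtain n :: "'a \<Rightarrow> int" where "\<And>j. x $ j = y $ j + of_int (n j)" by metis
  then have "x = y + (\<chi> j. of_int ((\<chi> j. n j) $ j))" by (simp add: vec_eq_iff)
  then show ?thesis using assms(1) unfolding torus_periodic_def by metis
qed

text \<open>The real coordinates of \<open>torus_embed\<close> are cosines and sines, which are
  combinations of characters; sums and products stay within \<open>trig_poly\<close>.\<close>

lemma trig_poly_real_polynomial_function:
  assumes "real_polynomial_function P"
  shows "trig_poly (\<lambda>x. of_real (P (torus_embed x)))"
  using assms
proof (induction P rule: real_polynomial_function.induct)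
  case (linear L)
  interpret bounded_linear L by fact
  \<comment> \<open>\<open>L\<close> is only real-linear, so its values on the real and the
    imaginary unit vector of each coordinate are independent data.\<close>
  define a b where "a j = complex_of_real (L (axis j 1))" and "b j = complex_of_real (L (axis j \<i>))" for j
  have embed: "torus_embed x = (\<Sum>j\<in>UNIV. cos (2 * pi * x $ j) *\<^sub>R axis j 1 + sin (2 * pi * x $ j) *\<^sub>R axis j \<i>)" for x :: "real^'a"
  proof (subst vec_eq_iff, rule allI)
    fix i
    have "(\<Sum>j\<in>UNIV. cos (2 * pi * x $ j) *\<^sub>R axis j 1 + sin (2 * pi * x $ j) *\<^sub>R axis j \<i>) $ i
        = (\<Sum>j\<in>UNIV. if j = i then cis (2 * pi * x $ j) else 0)"
      unfolding sum_component
      by (rule sum.cong) (auto simp: axis_def complex_eq_iff)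
    then show "torus_embed x $ i = (\<Sum>j\<in>UNIV. cos (2 * pi * x $ j) *\<^sub>R axis j 1 + sin (2 * pi * x $ j) *\<^sub>R axis j \<i>) $ i"
      by (simp add: torus_embed_def)
  qed
  \<comment> \<open>Euler's formulas turn \<open>a cos + b sin\<close> into frequencies 1 and -1
    with coefficients \<open>(a - i b) / 2\<close> and \<open>(a + i b) / 2\<close>.\<close>
  have "complex_of_real (L (torus_embed x)) =
      (\<Sum>j\<in>UNIV. (a j / 2 - \<i> * b j / 2) * torus_char (axis j 1) x + (a j / 2 + \<i> * b j / 2) * torus_char (axis j (- 1)) x)" for x
    unfolding embed sum add scaleR of_real_sum torus_char_axis a_def b_def
    by (rule sum.cong) (simp_all add: complex_eq_iff)
  then show ?case
    by (simp only:) (intro trig_poly_sum trig_poly.intros finite)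
next
  case (const c)
  show ?case by (rule trig_poly_const)
next
  case (add f g)
  then show ?case using trig_poly.add by simp
next
  case (mult f g)
  then show ?case using trig_poly_mult by simp
qed

lemma compact_torus_cube: "compact torus_cube"
  by (simp add: torus_cube_def compact_cbox)

text \<open>A periodic function factors through the embedding of the torus into a product of circles;
  the factor is continuous since the cube is compact, so Stone--Weierstrass applies to it there.\<close>
lemma trig_poly_dense:
  fixes u :: "real^'d \<Rightarrow> real"
  assumes per: "torus_periodic u" and cont: "continuous_on UNIV u" and "e > 0"
  obtains p where "trig_poly (\<lambda>x. complex_of_real (p x))" "\<And>x. x \<in> torus_cube \<Longrightarrow> \<bar>u x - p x\<bar> < e"
proof -
  define S where "S = (torus_embed ` torus_cube :: (complex^'d) set)"
  define F where "F z = u (inv torus_embed z)" for z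
  have F: "F (torus_embed x) = u x" for x
    unfolding F_def by (rule torus_embed_eq_imp_periodic_eq[OF per]) (simp add: f_inv_into_f)
  have S: "compact S"
    unfolding S_def by (intro compact_continuous_image continuous_on_torus_embed compact_torus_cube)
  have "continuous_on S F"
    unfolding continuous_on_closed_vimage[OF compact_imp_closed[OF S]]
  proof (intro allI impI)
    fix B :: "real set" assume B: "closed B"
    have "closed (u -` B)"
      by (rule continuous_closed_vimage[OF B]) (use cont in \<open>simp add: continuous_on_eq_continuous_at\<close>)
    then have "compact (torus_embed ` (u -` B \<inter> torus_cube))"
      by (intro compact_continuous_image continuous_on_torus_embed closed_Int_compact compact_torus_cube)
    moreover have "F -` B \<inter> S = torus_embed ` (u -` B \<inter> torus_cube)"
      by (auto simp: S_def F)
    ultimately show "closed (F -` B \<inter> S)" by (simp add: compact_imp_closed)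
  qed
  from Stone_Weierstrass_polynomial_function[OF S this \<open>e > 0\<close>]
  obtain P where "polynomial_function P" and P: "\<And>z. z \<in> S \<Longrightarrow> norm (F z - P z) < e" by blast
  then have "trig_poly (\<lambda>x. complex_of_real (P (torus_embed x)))"
    by (simp add: trig_poly_real_polynomial_function real_polynomial_function_eq)
  moreover have "\<bar>u x - P (torus_embed x)\<bar> < e" if "x \<in> torus_cube" for x
    using P[of "torus_embed x"] that by (simp add: F S_def)
  ultimately show ?thesis by (rule that)
qed

section \<open>Uniqueness of Fourier coefficients\<close>

lemma integrable_on_torus_cube:
  fixes g :: "real^'d \<Rightarrow> 'a::banach"
  shows "continuous_on UNIV g \<Longrightarrow> g integrable_on torus_cube"
  unfolding torus_cube_def by (intro integrable_continuous) (auto intro: continuous_on_subset)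

lemma torus_cube_representative:
  obtains n :: "int^'d" where "x + (\<chi> j. of_int (n $ j)) \<in> torus_cube"
proof
  have "- (1/2) \<le> x $ j - of_int (round (x $ j)) \<and> x $ j - of_int (round (x $ j)) \<le> 1/2" for j
    using of_int_round_abs_le[of "x $ j"] by linarith
  then show "x + (\<chi> j. of_int ((\<chi> j. - round (x $ j)) $ j)) \<in> torus_cube"
    by (simp add: torus_cube_def mem_box_cart)
qed

text \<open>Vanishing coefficients make \<open>u\<close> orthogonal to every trigonometric
  polynomial \<open>p\<close>, so the integral of \<open>u\<close> squared equals that of
  \<open>u (u - p)\<close>, which density makes arbitrarily small. A continuous nonnegative function
  with zero integral vanishes on the cube, and periodicity does the rest.\<close>

lemma zero_if_fourier_coeff_zero:
  fixes u :: "real^'d \<Rightarrow> real"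
  assumes per: "torus_periodic u" and cont: "continuous_on UNIV u"
    and zero: "\<And>m. fourier_coeff u m = 0"
  shows "u x = 0"
proof -
  have orth: "integral torus_cube (\<lambda>x. complex_of_real (u x) * p x) = 0" if "trig_poly p" for p
    using that
  proof (induction rule: trig_poly.induct)
    case (monomial c m)
    have "integral torus_cube (\<lambda>x. complex_of_real (u x) * (c * torus_char m x))
        = integral torus_cube (\<lambda>x. c * (complex_of_real (u x) * torus_char m x))"
      by (simp add: mult_ac)
    also have "\<dots> = c * fourier_coeff u (- m)" by (simp add: fourier_coeff_eq)
    finally show ?case using zero by simp
  next
    case (add p q)
    have "(\<lambda>x. complex_of_real (u x) * p x) integrable_on torus_cube"
         "(\<lambda>x. complex_of_real (u x) * q x) integrable_on torus_cube"
      using cont by (auto intro!: integrable_on_torus_cube continuous_intros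
          continuous_on_trig_poly[OF add.hyps(1)] continuous_on_trig_poly[OF add.hyps(2)])
    then show ?case using add.IH by (simp add: distrib_left integral_add)
  qed
  define I where "I = integral torus_cube (\<lambda>x. (u x)\<^sup>2)"
  define J where "J = integral torus_cube (\<lambda>x. \<bar>u x\<bar>)"
  have J: "J \<ge> 0" unfolding J_def
    by (rule integral_nonneg) (auto intro!: integrable_on_torus_cube continuous_intros cont)
  have bound: "I \<le> e * J" if "e > 0" for e
  proof -
    obtain p where p: "trig_poly (\<lambda>x. complex_of_real (p x))"
      and le: "\<And>x. x \<in> torus_cube \<Longrightarrow> \<bar>u x - p x\<bar> < e"
      using trig_poly_dense[OF per cont \<open>e > 0\<close>] by blast
    have contp: "continuous_on UNIV p"
      using continuous_on_Re[OF continuous_on_trig_poly[OF p, of UNIV]] by simp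
    have int: "(\<lambda>x. u x * p x) integrable_on torus_cube" "(\<lambda>x. u x * (u x - p x)) integrable_on torus_cube"
       "(\<lambda>x. e * \<bar>u x\<bar>) integrable_on torus_cube"
      using cont contp by (auto intro!: integrable_on_torus_cube continuous_intros)
    have orth_p: "integral torus_cube (\<lambda>x. u x * p x) = 0"
      using integral_linear[OF int(1) bounded_linear_of_real[where 'a = complex]] orth[OF p]
      by (simp add: o_def)
    have "I = integral torus_cube (\<lambda>x. u x * (u x - p x)) + integral torus_cube (\<lambda>x. u x * p x)"
      unfolding I_def integral_add[OF int(2,1), symmetric] by (simp add: algebra_simps power2_eq_square)
    also have "\<dots> = integral torus_cube (\<lambda>x. u x * (u x - p x))"
      by (simp add: orth_p)
    also have "\<dots> \<le> integral torus_cube (\<lambda>x. e * \<bar>u x\<bar>)"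
    proof (rule integral_le[OF int(2,3)])
      fix x :: "real^'d" assume "x \<in> torus_cube"
      have "u x * (u x - p x) \<le> \<bar>u x\<bar> * \<bar>u x - p x\<bar>" by (metis abs_ge_self abs_mult)
      also have "\<dots> \<le> \<bar>u x\<bar> * e" using le[OF \<open>x \<in> _\<close>] by (intro mult_left_mono) auto
      finally show "u x * (u x - p x) \<le> e * \<bar>u x\<bar>" by (simp add: mult.commute)
    qed
    also have "\<dots> = e * J" by (simp add: J_def)
    finally show ?thesis .
  qed
  have "I \<le> 0"
  proof (rule field_le_epsilon)
    fix e :: real assume "e > 0"
    \<comment> \<open>Dividing by \<open>J + 1\<close> instead of \<open>J\<close> covers the case
      \<open>J = 0\<close>.\<close>
    have "I \<le> e / (J + 1) * J" using \<open>e > 0\<close> J by (intro bound) auto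
    also have "\<dots> \<le> 0 + e" using \<open>e > 0\<close> J by (simp add: field_simps)
    finally show "I \<le> 0 + e" .
  qed
  moreover have "I \<ge> 0" unfolding I_def
    by (rule integral_nonneg) (auto intro!: integrable_on_torus_cube continuous_intros cont)
  ultimately have "((\<lambda>x. (u x)\<^sup>2) has_integral 0) torus_cube"
    using integrable_integral[OF integrable_on_torus_cube[of "\<lambda>x. (u x)\<^sup>2"]] cont
    by (simp add: I_def continuous_on_power)
  then have "(u x)\<^sup>2 = 0" if "x \<in> torus_cube" for x
    using has_integral_0_cbox_imp_0[OF _ _ _ _ that[unfolded torus_cube_def], of "\<lambda>x. (u x)\<^sup>2"]
    by (auto simp: torus_cube_def interval_ne_empty_cart
        intro!: continuous_intros continuous_on_subset[OF cont])
  moreover obtain n where "x + (\<chi> j. of_int (n $ j)) \<in> torus_cube" by (rule torus_cube_representative)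
  ultimately have "u (x + (\<chi> j. of_int (n $ j))) = 0" by simp
  then show ?thesis using per by (simp add: torus_periodic_def)
qed

section \<open>Absolutely convergent trigonometric series and Fourier inversion\<close>

lemma cnj_fourier_coeff: "cnj (fourier_coeff f m) = fourier_coeff f (- m)"
  by (simp add: fourier_coeff_eq Henstock_Kurzweil_Integration.integral_cnj cnj_torus_char)

context
  fixes c :: "int^'d \<Rightarrow> complex"
  assumes summable: "(\<lambda>m. norm (c m)) summable_on UNIV"
begin

lemma trig_series_uniform_limit:
  "uniform_limit UNIV (\<lambda>X x. \<Sum>m\<in>X. c m * torus_char m x) (\<lambda>x. \<Sum>\<^sub>\<infinity>m. c m * torus_char m x)
     (finite_subsets_at_top UNIV)"
  by (rule Weierstrass_m_test_general[OF _ summable]) (simp add: norm_mult)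

lemma continuous_on_trig_series: "continuous_on UNIV (\<lambda>x. \<Sum>\<^sub>\<infinity>m. c m * torus_char m x)"
  by (rule uniform_limit_theorem[OF _ trig_series_uniform_limit])
     (auto intro!: always_eventually continuous_intros)

text \<open>Absolute summability gives uniform convergence, also after multiplication by a character
  of modulus 1. Hence the series may be integrated term by term, and orthogonality keeps only the
  term \<open>m\<close>.\<close>

lemma integral_trig_series_torus_char:
  "integral torus_cube (\<lambda>x. (\<Sum>\<^sub>\<infinity>n. c n * torus_char n x) * torus_char (- m) x) = c m"
proof -
  let ?S = "\<lambda>X x. (\<Sum>n\<in>X. c n * torus_char n x) * torus_char (- m) x"
  let ?F = "finite_subsets_at_top (UNIV :: (int^'d) set)"
  have "uniform_limit UNIV (\<lambda>X x. \<Sum>n\<in>X. c n * torus_char n x * torus_char (- m) x)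
     (\<lambda>x. \<Sum>\<^sub>\<infinity>n. c n * torus_char n x * torus_char (- m) x) ?F"
    by (rule Weierstrass_m_test_general[OF _ summable]) (simp add: norm_mult)
  then have "uniform_limit UNIV ?S (\<lambda>x. (\<Sum>\<^sub>\<infinity>n. c n * torus_char n x) * torus_char (- m) x) ?F"
    by (simp add: sum_distrib_right infsum_cmult_left')
  then have "uniform_limit (cbox (\<chi> j. - 1/2) (\<chi> j. 1/2)) ?S
      (\<lambda>x. (\<Sum>\<^sub>\<infinity>n. c n * torus_char n x) * torus_char (- m) x) ?F"
    by (rule uniform_limit_on_subset) simp
  then obtain A B where A: "\<And>X. (?S X has_integral A X) torus_cube"
    and B: "((\<lambda>x. (\<Sum>\<^sub>\<infinity>n. c n * torus_char n x) * torus_char (- m) x) has_integral B) torus_cube"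
    and lim: "(A \<longlongrightarrow> B) ?F"
    unfolding torus_cube_def
    by (rule uniform_limit_integral_cbox) (auto intro!: continuous_intros)
  have A_eq: "A X = c m" if "finite X" "m \<in> X" for X
  proof -
    have "?S X = (\<lambda>x. \<Sum>n\<in>X. c n * torus_char (n - m) x)"
      by (simp add: sum_distrib_right mult.assoc flip: torus_char_add)
    then have "A X = integral torus_cube (\<lambda>x. \<Sum>n\<in>X. c n * torus_char (n - m) x)"
      using A[of X] by (simp add: integral_unique)
    also have "\<dots> = (\<Sum>n\<in>X. c n * (if n = m then 1 else 0))"
      by (subst integral_sum)
         (auto intro!: integrable_on_torus_cube continuous_intros \<open>finite X\<close> simp: integral_torus_char)
    also have "\<dots> = c m" using that by (simp add: if_distrib[of "(*) _"] cong: if_cong)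
    finally show ?thesis .
  qed
  \<comment> \<open>The integrals of the partial sums are constant as soon as the finite index set
    contains \<open>m\<close>.\<close>
  have "eventually (\<lambda>X. A X = c m) ?F"
    by (auto simp: eventually_finite_subsets_at_top intro!: exI[of _ "{m}"] A_eq)
  then have "(A \<longlongrightarrow> c m) ?F" by (rule tendsto_eventually)
  with lim have "B = c m" by (rule tendsto_unique[rotated]) simp
  with B show ?thesis by (simp add: integral_unique)
qed

end

text \<open>The series \<open>h\<close> is continuous and has the same coefficients as
  \<open>f\<close>, so uniqueness applies to the difference. Uniqueness is available for real
  functions, hence the subtraction of \<open>Re (h x)\<close> in place of
  \<open>h x\<close>.\<close>

theorem fourier_inversion:
  fixes f :: "real^'d \<Rightarrow> real"
  assumes per: "torus_periodic f" and cont: "continuous_on UNIV f"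
    and summable: "(\<lambda>m. norm (fourier_coeff f m)) summable_on UNIV"
  shows "f x = Re (\<Sum>\<^sub>\<infinity>m. fourier_coeff f m * torus_char m x)"
proof -
  define h where "h x = (\<Sum>\<^sub>\<infinity>m. fourier_coeff f m * torus_char m x)" for x
  define u where "u x = f x - Re (h x)" for x
  have conth: "continuous_on UNIV h"
    unfolding h_def by (rule continuous_on_trig_series[OF summable])
  have coeff_h: "integral torus_cube (\<lambda>x. h x * torus_char (- m) x) = fourier_coeff f m" for m
    unfolding h_def by (rule integral_trig_series_torus_char[OF summable])
  have "torus_periodic u"
    using per by (simp add: torus_periodic_def u_def h_def torus_char_periodic)
  moreover have "continuous_on UNIV u"
    unfolding u_def by (intro continuous_intros cont conth)
  moreover have "fourier_coeff u m = 0" for m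
  proof -
    have int: "(\<lambda>x. complex_of_real (f x) * torus_char (- m) x) integrable_on torus_cube"
      "(\<lambda>x. h x * torus_char (- m) x) integrable_on torus_cube"
      "(\<lambda>x. cnj (h x) * torus_char (- m) x) integrable_on torus_cube"
      using cont conth by (auto intro!: integrable_on_torus_cube continuous_intros)
    \<comment> \<open>Conjugating \<open>h\<close> conjugates its coefficients and reflects the
      frequency; as \<open>f\<close> is real, its coefficients are invariant under both together. So
      \<open>h\<close> and \<open>cnj h\<close>, and with them their mean \<open>Re h\<close>, share
      the coefficients of \<open>f\<close>.\<close>
    have "integral torus_cube (\<lambda>x. cnj (h x) * torus_char (- m) x)
        = cnj (integral torus_cube (\<lambda>x. h x * torus_char (- (- m)) x))"
      by (simp add: Henstock_Kurzweil_Integration.integral_cnj cnj_torus_char)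
    also have "\<dots> = fourier_coeff f m"
      unfolding coeff_h by (simp add: cnj_fourier_coeff)
    finally have cnj: "integral torus_cube (\<lambda>x. cnj (h x) * torus_char (- m) x) = fourier_coeff f m" .
    have "complex_of_real (u x) * torus_char (- m) x = complex_of_real (f x) * torus_char (- m) x
        - (h x * torus_char (- m) x + cnj (h x) * torus_char (- m) x) / 2" for x
    proof -
      have "complex_of_real (u x) = complex_of_real (f x) - (h x + cnj (h x)) / 2"
        by (simp add: u_def complex_add_cnj)
      then show ?thesis by (simp add: ring_distribs add_divide_distrib)
    qed
    then have "fourier_coeff u m = integral torus_cube (\<lambda>x. complex_of_real (f x) * torus_char (- m) x
        - (h x * torus_char (- m) x + cnj (h x) * torus_char (- m) x) / 2)"
      by (simp add: fourier_coeff_eq)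
    also have "\<dots> = fourier_coeff f m - (fourier_coeff f m + fourier_coeff f m) / 2"
      using int by (simp add: integral_diff integral_add integrable_add integrable_on_divide
        coeff_h cnj flip: fourier_coeff_eq)
    finally show ?thesis by simp
  qed
  ultimately have "u x = 0" by (rule zero_if_fourier_coeff_zero)
  then show ?thesis by (simp add: u_def h_def)
qed

section \<open>Lattice boxes and the distance on the torus\<close>

lemma card_vec_box:
  fixes A :: "'a set"
  assumes "finite A"
  shows "finite {m :: 'a^'d. \<forall>j. m $ j \<in> A}" "card {m :: 'a^'d. \<forall>j. m $ j \<in> A} = card A ^ CARD('d)"
proof -
  have "bij_betw vec_nth {m :: 'a^'d. \<forall>j. m $ j \<in> A} (UNIV \<rightarrow>\<^sub>E A)"
    by (rule bij_betwI[where g = vec_lambda]) auto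
  moreover have "finite ((UNIV :: 'd set) \<rightarrow>\<^sub>E A)" "card ((UNIV :: 'd set) \<rightarrow>\<^sub>E A) = card A ^ CARD('d)"
    using assms by (auto intro: finite_PiE simp: card_PiE)
  ultimately show "finite {m :: 'a^'d. \<forall>j. m $ j \<in> A}"
    "card {m :: 'a^'d. \<forall>j. m $ j \<in> A} = card A ^ CARD('d)"
    using bij_betw_finite bij_betw_same_card by fastforce+
qed

lemma abs_le_tnorm:
  assumes "\<bar>t\<bar> \<le> 1/2"
  shows "\<bar>t\<bar> \<le> tnorm t"
proof (cases "round t = 0")
  \<comment> \<open>This case does occur: 1/2 is rounded to 1. Then \<open>t\<close> is at distance
    at least 1/2 from its rounding.\<close>
  case False
  then have "real_of_int \<bar>round t\<bar> \<ge> 1" by linarith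
  then show ?thesis using assms by (simp add: tnorm_def)
qed (simp add: tnorm_def)

text \<open>Coordinates in the fundamental cube are already the representatives nearest to 0. This
  turns the sign hypothesis on \<open>f\<close>, phrased by torus distance, into one on
  coordinates.\<close>

lemma torus_dinf0_ge:
  assumes "x \<in> torus_cube" "\<bar>x $ j\<bar> \<ge> r"
  shows "torus_dinf0 x \<ge> r"
proof -
  have "- (1/2) \<le> x $ j \<and> x $ j \<le> 1/2"
    using assms(1) by (simp add: torus_cube_def mem_box_cart)
  then have "\<bar>x $ j\<bar> \<le> tnorm (x $ j)" by (intro abs_le_tnorm) auto
  also have "\<dots> \<le> torus_dinf0 x"
    unfolding torus_dinf0_def by (rule Max_ge) auto
  finally show ?thesis using assms(2) by simp
qed

section \<open>Comparison of the two norms under the sign conditions\<close>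

theorem mainTheorem13:
  fixes f :: "real^'d \<Rightarrow> real" and s :: real and r :: real and k :: int
  assumes "s = 1 \<or> s = -1"
    and "torus_periodic f"
    and "continuous_on UNIV f"
    and "\<forall>x. f (- x) = f x"
    and "\<exists>x. f x \<noteq> 0"
    and "(\<lambda>m. norm (fourier_coeff f m)) summable_on UNIV"
    and "0 < r" and "r \<le> 1" and "k \<ge> 1"
    and "\<forall>x. torus_dinf0 x \<ge> r \<longrightarrow> f x \<ge> 0"
    and "Im (fourier_coeff f 0) = 0 \<and> Re (fourier_coeff f 0) \<le> 0"
    and "\<forall>m. (\<exists>j. \<bar>m $ j\<bar> \<ge> k) \<longrightarrow>
           Im (fourier_coeff f m) = 0 \<and> s * Re (fourier_coeff f m) \<ge> 0"
    and "s * f 0 \<le> 0"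
  shows "r * (2 * of_int k - 1) \<ge> 2 powr (- (1 + 4 / real CARD('d)))"
proof -
  note cont = \<open>continuous_on UNIV f\<close> and abs_sum = \<open>(\<lambda>m. norm (fourier_coeff f m)) summable_on UNIV\<close>
  have s: "\<bar>s\<bar> = 1" using assms(1) by auto
  let ?c = "fourier_coeff f" and ?d = "CARD('d)"
  define M where "M = (\<Sum>\<^sub>\<infinity>m. norm (?c m))"
  define I where "I = integral torus_cube (\<lambda>x. \<bar>f x\<bar>)"
  have sum_c: "?c summable_on UNIV" using abs_sum by (rule abs_summable_summable)
  have inv: "f x = Re (\<Sum>\<^sub>\<infinity>m. ?c m * torus_char m x)" for x
    by (rule fourier_inversion[OF assms(2) cont abs_sum])

  have sup_le: "\<bar>f x\<bar> \<le> M" for x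
  proof -
    have "\<bar>f x\<bar> \<le> norm (\<Sum>\<^sub>\<infinity>m. ?c m * torus_char m x)"
      unfolding inv[of x] by (rule abs_Re_le_cmod)
    also have "\<dots> \<le> (\<Sum>\<^sub>\<infinity>m. norm (?c m * torus_char m x))"
      by (rule norm_infsum_bound) (use abs_sum in \<open>simp add: norm_mult\<close>)
    finally show ?thesis by (simp add: M_def norm_mult)
  qed
  \<comment> \<open>Since \<open>f\<close> is nonzero, \<open>M\<close> is positive and can be
    cancelled at the end.\<close>
  obtain x0 where "f x0 \<noteq> 0" using assms(5) by blast
  then have "M > 0" using sup_le[of x0] by linarith

  have coeff_le: "norm (?c m) \<le> I" for m
    unfolding I_def fourier_coeff_eq
    by (rule Henstock_Kurzweil_Integration.integral_norm_bound_integral)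
       (use cont in \<open>auto intro!: integrable_on_torus_cube continuous_intros simp: norm_mult\<close>)

  \<comment> \<open>The frequencies not covered by the sign hypothesis: the open interval holds
    \<open>2 * k - 1\<close> integers per coordinate.\<close>
  define K where "K = {m :: int^'d. \<forall>j. m $ j \<in> {- k<..<k}}"
  have K: "finite K" "real (card K) = (2 * of_int k - 1) ^ ?d"
    using card_vec_box[of "{- k<..<k}", where 'd = 'd] \<open>k \<ge> 1\<close> by (auto simp: K_def)
  have M_le: "M \<le> 2 * (2 * of_int k - 1) ^ ?d * I"
  proof -
    have sum_Re: "(\<lambda>m. s * Re (?c m)) summable_on UNIV"
      by (intro summable_on_cmult_right summable_on_Re sum_c)
    \<comment> \<open>By inversion at 0, where all characters equal 1, \<open>f 0\<close> is the sum
      of the real parts of the coefficients. Subtracting \<open>s * f 0\<close> cancels every term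
      outside \<open>K\<close>, where the modulus equals \<open>s * Re (?c m)\<close>.\<close>
    have "M \<le> M - s * f 0" using \<open>s * f 0 \<le> 0\<close> by simp
    also have "s * f 0 = (\<Sum>\<^sub>\<infinity>m. s * Re (?c m))"
      using sum_c by (simp add: inv[of 0] infsum_cmult_right' infsum_Re)
    also have "M - \<dots> = (\<Sum>\<^sub>\<infinity>m. norm (?c m) - s * Re (?c m))"
      unfolding M_def
      using infsum_add[OF abs_sum summable_on_uminus[THEN iffD2, OF sum_Re]] by (simp add: infsum_uminus)
    also have "\<dots> = (\<Sum>\<^sub>\<infinity>m\<in>K. norm (?c m) - s * Re (?c m))"
    proof (rule infsum_cong_neutral)
      fix m assume "m \<in> UNIV - K"
      then obtain j where "m $ j \<notin> {- k<..<k}" unfolding K_def by blast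
      then have "\<bar>m $ j\<bar> \<ge> k" by auto
      then have Im: "Im (?c m) = 0" and Re: "s * Re (?c m) \<ge> 0" using assms(12) by blast+
      have "norm (?c m) = \<bar>s * Re (?c m)\<bar>" using Im s by (simp add: cmod_def abs_mult)
      then show "norm (?c m) - s * Re (?c m) = 0" using Re by simp
    qed auto
    also have "\<dots> = (\<Sum>m\<in>K. norm (?c m) - s * Re (?c m))" using K by simp
    also have "\<dots> \<le> (\<Sum>m\<in>K. 2 * I)"
    proof (rule sum_mono)
      fix m
      have "\<bar>s * Re (?c m)\<bar> \<le> norm (?c m)" using s by (simp add: abs_mult abs_Re_le_cmod)
      then show "norm (?c m) - s * Re (?c m) \<le> 2 * I" using coeff_le[of m] by linarith
    qed
    finally show ?thesis by (simp add: K(2) mult_ac)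
  qed

  define B :: "(real^'d) set" where "B = cbox (\<chi> j. - r) (\<chi> j. r)"
  have I_le: "I \<le> 2 * M * (2 * r) ^ ?d"
  proof -
    have "cbox (\<chi> j. - r) (\<chi> j. r) \<noteq> ({} :: (real^'d) set)"
      using \<open>0 < r\<close> by (simp add: interval_ne_empty_cart)
    then have content_B: "measure lborel B = (2 * r) ^ ?d"
      by (simp add: B_def content_cbox_cart)
    \<comment> \<open>For \<open>r\<close> above 1/2 the box \<open>B\<close> sticks out of the
      fundamental cube, so the integration is over the intersection, later enlarged to
      \<open>B\<close>.\<close>
    obtain a b where cbox: "B \<inter> torus_cube = cbox a b"
      unfolding torus_cube_def B_def Int_interval by blast
    have int: "f integrable_on torus_cube" "(\<lambda>x. \<bar>f x\<bar>) integrable_on torus_cube"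
      "(\<lambda>x. if x \<in> B then 2 * M else 0) integrable_on torus_cube"
      using cont by (auto intro!: integrable_on_torus_cube continuous_intros
        simp: integrable_restrict_Int Int_commute cbox integrable_const)
    have "complex_of_real (integral torus_cube f) = ?c 0"
      using integral_linear[OF int(1) bounded_linear_of_real[where 'a = complex]]
      by (simp add: fourier_coeff_eq o_def)
    then have int_f: "integral torus_cube f \<le> 0"
      using assms(11) by (metis Re_complex_of_real)
    have "I \<le> integral torus_cube (\<lambda>x. f x + (if x \<in> B then 2 * M else 0))"
      unfolding I_def
    proof (rule integral_le[OF int(2) integrable_add[OF int(1,3)]])
      fix x :: "real^'d" assume x: "x \<in> torus_cube"
      show "\<bar>f x\<bar> \<le> f x + (if x \<in> B then 2 * M else 0)"
      proof (cases "x \<in> B")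
        case True
        then show ?thesis using sup_le[of x] by (simp add: abs_le_iff)
      next
        case False
        then obtain j where "\<not> (- r \<le> x $ j \<and> x $ j \<le> r)" by (auto simp: B_def mem_box_cart)
        then have "\<bar>x $ j\<bar> \<ge> r" by auto
        with x have "f x \<ge> 0" using assms(10) torus_dinf0_ge by blast
        then show ?thesis using False by simp
      qed
    qed
    also have "\<dots> = integral torus_cube f + integral (B \<inter> torus_cube) (\<lambda>x. 2 * M)"
      by (simp add: integral_add[OF int(1,3)] integral_restrict_Int Int_commute)
    also have "\<dots> \<le> integral (B \<inter> torus_cube) (\<lambda>x. 2 * M)" using int_f by simp
    also have "\<dots> \<le> integral B (\<lambda>x. 2 * M)"
      using \<open>M > 0\<close> by (intro integral_subset_le)
        (simp, simp_all add: cbox integrable_const, simp add: B_def integrable_const)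
    also have "\<dots> = 2 * M * (2 * r) ^ ?d"
      using content_B by (simp add: B_def)
    finally show ?thesis .
  qed

  define y where "y = r * (2 * of_int k - 1)"
  have "y > 0" using \<open>0 < r\<close> \<open>k \<ge> 1\<close> by (simp add: y_def)
  have "M \<le> 2 * (2 * of_int k - 1) ^ ?d * (2 * M * (2 * r) ^ ?d)"
    using M_le I_le \<open>k \<ge> 1\<close> by (elim order_trans) (intro mult_left_mono, auto)
  also have "\<dots> = M * (4 * (2 * y) ^ ?d)"
    by (simp add: y_def power_mult_distrib)
  finally have "1/4 \<le> (2 * y) ^ ?d" using \<open>M > 0\<close> by simp
  \<comment> \<open>Below the claimed threshold \<open>2 * y\<close> is less than
    \<open>2 powr (- 4 / d)\<close>, so its power is less than 1/16, which leaves a factor 4 to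
    spare.\<close>
  moreover have "(2 * y) ^ ?d < 1/4" if "y < 2 powr (- (1 + 4 / real ?d))"
  proof -
    have "2 * y < 2 * 2 powr (- (1 + 4 / real ?d))" using that by simp
    also have "\<dots> = 2 powr (- 4 / real ?d)"
      using powr_mult_base[of 2 "- (1 + 4 / real ?d)"] by simp
    finally have "(2 * y) ^ ?d < (2 powr (- 4 / real ?d)) ^ ?d"
      using \<open>y > 0\<close> by (intro power_strict_mono) auto
    also have "\<dots> = 2 powr (- 4)"
      by (simp add: powr_realpow[symmetric] powr_powr)
    also have "\<dots> < 1/4" by (simp add: powr_minus)
    finally show ?thesis .
  qed
  ultimately show ?thesis unfolding y_def by linarith
qed

end
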